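(* Let $H$ be a Hilbert space of dimension $n<\infty$, let $H_1,\dots,H_m$ be Hilbert spaces with $\dim H_j=l_j<\infty$, and put $l=\sum_{j=1}^m l_j$. Let $\{V_j\}_{j=1}^m$, $V_j\in B(H,H_j)$, be a Parseval (OPV)-frame for $H$. If $l\ge 2n$, then there are infinitely many tight dual (OPV)-frames for $\{V_j\}_{j=1}^m$.
   Context: Hilbert spaces are over $\mathbb{R}$ or $\mathbb{C}$ and nonzero. A family $V_j\in B(H,H_j)$, $j=1,\dots,m$, is an operator-valued frame ((OPV)-frame) for $H$ if there are constants $A,B>0$ with $AI\le\sum_{j=1}^m V_j^*V_j\le BI$; it is tight with frame bound $A>0$ if $\sum_{j=1}^m V_j^*V_j=AI$, and Parseval if it is tight with $A=1$. An (OPV)-frame $\{W_j\}_{j=1}^m$, $W_j\in B(H,H_j)$, is dual to $\{V_j\}_{j=1}^m$ if $\sum_{j=1}^m W_j^*V_j=I$. *)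

theory Defs
  imports
    "HOL-Analysis.Abstract_Metric_Spaces"
    "HOL-Library.FuncSet"
    "Jordan_Normal_Form.Missing_VectorSpace"
begin

section \<open>Hilbert spaces over the reals or the complex numbers\<close>

text \<open>
  Both scalar fields are treated uniformly: the field is \<open>scalar_field K\<close>, where \<open>K\<close> is one of the
  sets \<open>\<real>\<close> and \<open>UNIV\<close> of complex numbers. For \<open>K = \<real>\<close> the conjugation in the
  symmetry axiom of the inner product is trivial.

  Spaces carry their own carrier set and operations, so that the members of a family of spaces,
  though built on one type, may be unrelated and have different dimensions.
\<close>

definition scalar_field :: "complex set \<Rightarrow> complex ring" where
  "scalar_field K = \<lparr>carrier = K, monoid.mult = (*), one = 1, zero = 0, add = (+)\<rparr>"

record 'a hspace = "(complex, 'a) module" +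
  ip :: "'a \<Rightarrow> 'a \<Rightarrow> complex"

definition hnorm :: "'a hspace \<Rightarrow> 'a \<Rightarrow> real" where
  "hnorm H x = sqrt (Re (ip H x x))"

definition hdist :: "'a hspace \<Rightarrow> 'a \<Rightarrow> 'a \<Rightarrow> real" where
  "hdist H x y = hnorm H (x \<ominus>\<^bsub>H\<^esub> y)"

text \<open>The symmetry axiom makes \<open>ip x x\<close> real, so positivity is a statement about its real part.\<close>

locale hilbert_space = vectorspace "scalar_field K" H
  for K :: "complex set" and H :: "'a hspace" (structure) +
  assumes real_or_complex: "K = \<real> \<or> K = UNIV"
    and ip_closed: "\<lbrakk>x \<in> carrier H; y \<in> carrier H\<rbrakk> \<Longrightarrow> ip H x y \<in> K"
    and ip_add_left: "\<lbrakk>x \<in> carrier H; y \<in> carrier H; z \<in> carrier H\<rbrakk> \<Longrightarrow>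
          ip H (x \<oplus> y) z = ip H x z + ip H y z"
    and ip_scale_left: "\<lbrakk>c \<in> K; x \<in> carrier H; y \<in> carrier H\<rbrakk> \<Longrightarrow>
          ip H (c \<odot> x) y = c * ip H x y"
    and ip_sym: "\<lbrakk>x \<in> carrier H; y \<in> carrier H\<rbrakk> \<Longrightarrow> ip H y x = cnj (ip H x y)"
    and ip_pos: "\<lbrakk>x \<in> carrier H; x \<noteq> \<zero>\<rbrakk> \<Longrightarrow> Re (ip H x x) > 0"
    and complete: "Metric_space.mcomplete (carrier H) (hdist H)"
    and nonzero: "carrier H \<noteq> {\<zero>}"

definition hilbert_space_of_dim :: "complex set \<Rightarrow> 'a hspace \<Rightarrow> nat \<Rightarrow> bool" where
  "hilbert_space_of_dim K H n \<longleftrightarrow> hilbert_space K H \<and>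
     vectorspace.fin_dim (scalar_field K) H \<and> vectorspace.dim (scalar_field K) H = n"

section \<open>Bounded operators\<close>

text \<open>
  Operators are extensional, i.e. equal to \<open>undefined\<close> outside the carrier of their domain, so that
  HOL equality of operators is equality on the domain. This matters for counting operators.
\<close>

definition bounded_ops :: "complex set \<Rightarrow> 'a hspace \<Rightarrow> 'b hspace \<Rightarrow> ('a \<Rightarrow> 'b) set" where
  "bounded_ops K H G = {T. T \<in> LinearCombinations.module_hom (scalar_field K) H G \<and>
     T \<in> extensional (carrier H) \<and>
     (\<exists>C. \<forall>x\<in>carrier H. hnorm G (T x) \<le> C * hnorm H x)}"

definition hadjoint :: "complex set \<Rightarrow> 'a hspace \<Rightarrow> 'b hspace \<Rightarrow> ('a \<Rightarrow> 'b) \<Rightarrow> 'b \<Rightarrow> 'a" where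
  "hadjoint K H G T = (THE S. S \<in> bounded_ops K G H \<and>
     (\<forall>x\<in>carrier H. \<forall>y\<in>carrier G. ip G (T x) y = ip H x (S y)))"

definition scaled_id :: "'a hspace \<Rightarrow> real \<Rightarrow> 'a \<Rightarrow> 'a" where
  "scaled_id H a = (\<lambda>x\<in>carrier H. complex_of_real a \<odot>\<^bsub>H\<^esub> x)"

definition selfadjoint :: "complex set \<Rightarrow> 'a hspace \<Rightarrow> ('a \<Rightarrow> 'a) \<Rightarrow> bool" where
  "selfadjoint K H T \<longleftrightarrow> T \<in> bounded_ops K H H \<and> hadjoint K H H T = T"

definition op_le :: "complex set \<Rightarrow> 'a hspace \<Rightarrow> ('a \<Rightarrow> 'a) \<Rightarrow> ('a \<Rightarrow> 'a) \<Rightarrow> bool" where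
  "op_le K H S T \<longleftrightarrow> selfadjoint K H S \<and> selfadjoint K H T \<and>
     (\<forall>x\<in>carrier H. Re (ip H (S x) x) \<le> Re (ip H (T x) x))"

section \<open>Operator-valued frames\<close>

text \<open>The operator \<open>\<Sum>\<^sub>j W\<^sub>j\<^sup>* V\<^sub>j\<close>, \<open>j = 1, \<dots>, m\<close>, on \<open>H\<close>.\<close>

definition mixed_frame_op :: "complex set \<Rightarrow> 'a hspace \<Rightarrow> nat \<Rightarrow> (nat \<Rightarrow> 'b hspace) \<Rightarrow>
    (nat \<Rightarrow> 'a \<Rightarrow> 'b) \<Rightarrow> (nat \<Rightarrow> 'a \<Rightarrow> 'b) \<Rightarrow> 'a \<Rightarrow> 'a" where
  "mixed_frame_op K H m G W V =
     (\<lambda>x\<in>carrier H. \<Oplus>\<^bsub>H\<^esub>j\<in>{1..m}. hadjoint K H (G j) (W j) (V j x))"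

text \<open>Families are extensional in the index \<open>j\<close> as well, again because they are counted.\<close>

definition opv_frame :: "complex set \<Rightarrow> 'a hspace \<Rightarrow> nat \<Rightarrow> (nat \<Rightarrow> 'b hspace) \<Rightarrow>
    (nat \<Rightarrow> 'a \<Rightarrow> 'b) \<Rightarrow> bool" where
  "opv_frame K H m G V \<longleftrightarrow> V \<in> (\<Pi>\<^sub>E j\<in>{1..m}. bounded_ops K H (G j)) \<and>
     (\<exists>A B. A > 0 \<and> B > 0 \<and>
        op_le K H (scaled_id H A) (mixed_frame_op K H m G V V) \<and>
        op_le K H (mixed_frame_op K H m G V V) (scaled_id H B))"

definition tight_opv_frame_with_bound :: "complex set \<Rightarrow> 'a hspace \<Rightarrow> nat \<Rightarrow>
    (nat \<Rightarrow> 'b hspace) \<Rightarrow> real \<Rightarrow> (nat \<Rightarrow> 'a \<Rightarrow> 'b) \<Rightarrow> bool" where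
  "tight_opv_frame_with_bound K H m G A V \<longleftrightarrow>
     opv_frame K H m G V \<and> A > 0 \<and> mixed_frame_op K H m G V V = scaled_id H A"

definition tight_opv_frame :: "complex set \<Rightarrow> 'a hspace \<Rightarrow> nat \<Rightarrow> (nat \<Rightarrow> 'b hspace) \<Rightarrow>
    (nat \<Rightarrow> 'a \<Rightarrow> 'b) \<Rightarrow> bool" where
  "tight_opv_frame K H m G V \<longleftrightarrow> (\<exists>A. tight_opv_frame_with_bound K H m G A V)"

definition parseval_opv_frame :: "complex set \<Rightarrow> 'a hspace \<Rightarrow> nat \<Rightarrow> (nat \<Rightarrow> 'b hspace) \<Rightarrow>
    (nat \<Rightarrow> 'a \<Rightarrow> 'b) \<Rightarrow> bool" where
  "parseval_opv_frame K H m G V \<longleftrightarrow> tight_opv_frame_with_bound K H m G 1 V"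

definition dual_opv_frame :: "complex set \<Rightarrow> 'a hspace \<Rightarrow> nat \<Rightarrow> (nat \<Rightarrow> 'b hspace) \<Rightarrow>
    (nat \<Rightarrow> 'a \<Rightarrow> 'b) \<Rightarrow> (nat \<Rightarrow> 'a \<Rightarrow> 'b) \<Rightarrow> bool" where
  "dual_opv_frame K H m G V W \<longleftrightarrow>
     opv_frame K H m G W \<and> mixed_frame_op K H m G W V = scaled_id H 1"

end

theory Submission
  imports Defs
begin

text \<open>
  A Parseval frame \<open>V\<close> is an isometry \<open>T x = (V\<^sub>j x)\<^sub>j\<close> of \<open>H\<close> into the direct sum \<open>D\<close> of the \<open>H\<^sub>j\<close>.
  As \<open>dim D = l \<ge> 2 n\<close>, the orthogonal complement of its range has dimension at least \<open>n\<close> and hence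
  admits an isometry \<open>U\<close> from \<open>H\<close>. The components of \<open>T + c U\<close> form a dual of \<open>V\<close>,
  because \<open>U\<^sup>* T = 0\<close>, and they are tight with bound \<open>1 + c\<^sup>2\<close>; different \<open>c \<ge> 0\<close> give different
  bounds, hence different duals.
\<close>

text \<open>The argument forms neither the orthogonal complement nor the algebraic dimension of the
  direct sum; it counts orthonormal vectors. Orthonormal bases of one space are equally large, so at
  least l - n \<ge> n vectors are new, and matching n of them with \<open>E\<close> defines the
  second isometry. Only this count uses l \<ge> 2n. The other obstacle is \<open>hadjoint\<close>, a
  definite description: a frame operator says nothing until existence and uniqueness of adjoints are
  known. After that, an equation between a mixed frame operator and a multiple of the identity is an
  identity between inner products in the direct sum, where no adjoint appears, and duality and
  tightness follow by expanding sums.\<close>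

lemma scalar_field_simps [simp]:
  "carrier (scalar_field K) = K"
  "x \<otimes>\<^bsub>scalar_field K\<^esub> y = x * y"
  "x \<oplus>\<^bsub>scalar_field K\<^esub> y = x + y"
  "\<one>\<^bsub>scalar_field K\<^esub> = 1"
  "\<zero>\<^bsub>scalar_field K\<^esub> = 0"
  by (simp_all add: scalar_field_def)

section \<open>Orthonormal sets in inner product spaces\<close>

definition orthonormal_set :: "'a hspace \<Rightarrow> 'a set \<Rightarrow> bool" where
  "orthonormal_set H A \<longleftrightarrow> finite A \<and> A \<subseteq> carrier H \<and>
     (\<forall>x\<in>A. \<forall>y\<in>A. ip H x y = (if x = y then 1 else 0))"

text \<open>Maximality instead of spanning: when it fails, it hands over a nonzero vector orthogonal
  to \<open>A\<close>, which is what the extension argument consumes. Spanning is recovered by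
  \<open>orthonormal_basis_expansion\<close>.\<close>

definition orthonormal_basis :: "'a hspace \<Rightarrow> 'a set \<Rightarrow> bool" where
  "orthonormal_basis H A \<longleftrightarrow> orthonormal_set H A \<and>
     (\<forall>x\<in>carrier H. (\<forall>a\<in>A. ip H x a = 0) \<longrightarrow> x = \<zero>\<^bsub>H\<^esub>)"

text \<open>
  The axioms of \<open>hilbert_space\<close> without completeness, so that none has to be shown for direct sums.
\<close>

locale inner_product_space = vectorspace "scalar_field K" H
  for K :: "complex set" and H :: "'a hspace" (structure) +
  assumes real_or_complex: "K = \<real> \<or> K = UNIV"
    and ip_closed: "\<lbrakk>x \<in> carrier H; y \<in> carrier H\<rbrakk> \<Longrightarrow> ip H x y \<in> K"
    and ip_add_left: "\<lbrakk>x \<in> carrier H; y \<in> carrier H; z \<in> carrier H\<rbrakk> \<Longrightarrow>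
          ip H (x \<oplus> y) z = ip H x z + ip H y z"
    and ip_scale_left: "\<lbrakk>c \<in> K; x \<in> carrier H; y \<in> carrier H\<rbrakk> \<Longrightarrow>
          ip H (c \<odot> x) y = c * ip H x y"
    and ip_sym: "\<lbrakk>x \<in> carrier H; y \<in> carrier H\<rbrakk> \<Longrightarrow> ip H y x = cnj (ip H x y)"
    and ip_pos: "\<lbrakk>x \<in> carrier H; x \<noteq> \<zero>\<rbrakk> \<Longrightarrow> Re (ip H x x) > 0"
begin

section \<open>Elementary rules for inner products\<close>

lemma K_closed [simp]:
  "complex_of_real r \<in> K"
  "a \<in> K \<Longrightarrow> b \<in> K \<Longrightarrow> a + b \<in> K"
  "a \<in> K \<Longrightarrow> b \<in> K \<Longrightarrow> a * b \<in> K"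
  "a \<in> K \<Longrightarrow> cnj a \<in> K"
  using real_or_complex by (auto simp: Reals_cnj_iff)

lemma smult_mem [simp]: "c \<in> K \<Longrightarrow> x \<in> carrier H \<Longrightarrow> c \<odot> x \<in> carrier H"
  using smult_closed[of c x] by simp

lemma ip_zero_left: "x \<in> carrier H \<Longrightarrow> ip H \<zero> x = 0"
  using ip_add_left[of "\<zero>" "\<zero>" x] by simp

lemma ip_minus_left:
  assumes "x \<in> carrier H" "y \<in> carrier H" "z \<in> carrier H"
  shows "ip H (x \<ominus> y) z = ip H x z - ip H y z"
proof -
  have "ip H (\<ominus> y) z + ip H y z = ip H (\<ominus> y \<oplus> y) z"
    using assms by (intro ip_add_left[symmetric]) auto
  also have "\<dots> = 0"
    using assms by (simp add: M.l_neg ip_zero_left)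
  finally have "ip H (\<ominus> y) z = - ip H y z"
    by (simp add: add_eq_0_iff2)
  then show ?thesis
    using assms by (simp add: a_minus_def ip_add_left)
qed

lemma ip_add_right:
  "\<lbrakk>x \<in> carrier H; y \<in> carrier H; z \<in> carrier H\<rbrakk> \<Longrightarrow> ip H z (x \<oplus> y) = ip H z x + ip H z y"
  by (simp add: ip_sym[of _ z] ip_add_left)

lemma ip_scale_right:
  "\<lbrakk>c \<in> K; x \<in> carrier H; y \<in> carrier H\<rbrakk> \<Longrightarrow> ip H y (c \<odot> x) = cnj c * ip H y x"
  by (simp add: ip_sym[of _ y] ip_scale_left)

lemma ip_self_of_real: "x \<in> carrier H \<Longrightarrow> ip H x x = complex_of_real (Re (ip H x x))"
  by (metis Reals_cnj_iff ip_sym of_real_Re)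

lemma ip_self_nonneg: "x \<in> carrier H \<Longrightarrow> Re (ip H x x) \<ge> 0"
  by (cases "x = \<zero>") (auto simp: ip_zero_left dest: ip_pos)

lemma hnorm_power2: "x \<in> carrier H \<Longrightarrow> (hnorm H x)\<^sup>2 = Re (ip H x x)"
  by (simp add: hnorm_def ip_self_nonneg)

lemma hnorm_nonneg: "x \<in> carrier H \<Longrightarrow> hnorm H x \<ge> 0"
  by (simp add: hnorm_def ip_self_nonneg)

text \<open>Test with the difference of the two vectors and use definiteness. This turns vector
  equations into scalar ones and later yields linearity of maps known only through their inner
  products.\<close>

lemma ip_eqI:
  assumes "x \<in> carrier H" "y \<in> carrier H"
    and "\<And>z. z \<in> carrier H \<Longrightarrow> ip H x z = ip H y z"
  shows "x = y"
proof -
  have "ip H (x \<ominus> y) (x \<ominus> y) = 0"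
    using assms by (simp add: ip_minus_left)
  then have "x \<ominus> y = \<zero>"
    using assms ip_pos[of "x \<ominus> y"] by auto
  then show ?thesis
    using assms by simp
qed

section \<open>Finite linear combinations\<close>

lemma lincomb_mem [simp]:
  "A \<subseteq> carrier H \<Longrightarrow> a \<in> A \<rightarrow> K \<Longrightarrow> lincomb a A \<in> carrier H"
  using lincomb_closed[of A a] by simp

text \<open>Stated for an arbitrary scalar functional so that it also covers
  \<open>\<lambda>x. ip G (T x) y\<close> for a linear \<open>T\<close>, where the combination sits
  inside the operator.\<close>

lemma linear_functional_lincomb:
  fixes f :: "'a \<Rightarrow> complex"
  assumes "finite A" "A \<subseteq> carrier H" "a \<in> A \<rightarrow> K"
    and add: "\<And>x y. x \<in> carrier H \<Longrightarrow> y \<in> carrier H \<Longrightarrow> f (x \<oplus> y) = f x + f y"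
    and scale: "\<And>c x. c \<in> K \<Longrightarrow> x \<in> carrier H \<Longrightarrow> f (c \<odot> x) = c * f x"
  shows "f (lincomb a A) = (\<Sum>b\<in>A. a b * f b)"
  using assms(1-3)
proof (induction A rule: finite_induct)
  case empty
  have "f \<zero> = 0"
    using add[of "\<zero>" "\<zero>"] by simp
  then show ?case
    by (simp add: lincomb_def)
next
  case (insert b A)
  then have b: "b \<in> carrier H" "a b \<in> K" and A: "A \<subseteq> carrier H" "a \<in> A \<rightarrow> K"
    by auto
  have "lincomb a (insert b A) = a b \<odot> b \<oplus> lincomb a A"
    unfolding lincomb_def using insert.hyps b A by (subst M.finsum_insert) (auto simp: subset_iff Pi_iff)
  then show ?case
    using insert b A by (simp add: add scale)
qed

lemma ip_lincomb_left:
  assumes "finite A" "A \<subseteq> carrier H" "a \<in> A \<rightarrow> K" "y \<in> carrier H"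
  shows "ip H (lincomb a A) y = (\<Sum>b\<in>A. a b * ip H b y)"
  using assms by (intro linear_functional_lincomb) (auto simp: ip_add_left ip_scale_left)

lemma ip_lincomb_right:
  assumes "finite A" "A \<subseteq> carrier H" "a \<in> A \<rightarrow> K" "y \<in> carrier H"
  shows "ip H y (lincomb a A) = (\<Sum>b\<in>A. cnj (a b) * ip H y b)"
proof -
  have "ip H y (lincomb a A) = cnj (ip H (lincomb a A) y)"
    using assms by (intro ip_sym) auto
  also have "\<dots> = (\<Sum>b\<in>A. cnj (a b) * cnj (ip H b y))"
    using assms by (simp add: ip_lincomb_left)
  also have "\<dots> = (\<Sum>b\<in>A. cnj (a b) * ip H y b)"
    using assms by (intro sum.cong refl) (metis ip_sym subsetD)
  finally show ?thesis .
qed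

lemma ip_finsum_left:
  assumes "finite J" "f \<in> J \<rightarrow> carrier H" "y \<in> carrier H"
  shows "ip H (\<Oplus>j\<in>J. f j) y = (\<Sum>j\<in>J. ip H (f j) y)"
  using assms by (induction J rule: finite_induct) (auto simp: ip_zero_left ip_add_left Pi_iff)

lemma ip_lincomb_orthonormal:
  assumes A: "orthonormal_set H A" and "a \<in> A \<rightarrow> K" "b \<in> A"
  shows "ip H (lincomb a A) b = a b"
proof -
  have "ip H (lincomb a A) b = (\<Sum>c\<in>A. a c * ip H c b)"
    using assms by (intro ip_lincomb_left) (auto simp: orthonormal_set_def)
  also have "\<dots> = (\<Sum>c\<in>A. if c = b then a c else 0)"
    using A assms(3) by (intro sum.cong) (auto simp: orthonormal_set_def)
  also have "\<dots> = a b"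
    using assms by (simp add: orthonormal_set_def)
  finally show ?thesis .
qed

section \<open>Bessel's inequality, Parseval's identity and the size of orthonormal sets\<close>

lemma ip_mult_ip_swap:
  "x \<in> carrier H \<Longrightarrow> y \<in> carrier H \<Longrightarrow> ip H x y * ip H y x = complex_of_real ((cmod (ip H x y))\<^sup>2)"
  by (metis complex_norm_square ip_sym)

text \<open>With \<open>p\<close> the projection of \<open>x\<close> to the span of
  \<open>A\<close>, the residual \<open>x \<ominus> p\<close> is orthogonal to \<open>p\<close>, so
  its squared norm is \<open>ip H x x\<close> minus the sum, and it is nonnegative.\<close>

lemma bessel:
  assumes A: "orthonormal_set H A" and x: "x \<in> carrier H"
  shows "(\<Sum>a\<in>A. (cmod (ip H x a))\<^sup>2) \<le> Re (ip H x x)"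
proof -
  have fin: "finite A" "A \<subseteq> carrier H"
    using A by (auto simp: orthonormal_set_def)
  have c: "ip H x \<in> A \<rightarrow> K"
    using fin x by (auto intro: ip_closed)
  define p where "p = lincomb (ip H x) A"
  have p: "p \<in> carrier H"
    unfolding p_def using fin c by simp
  have r: "x \<ominus> p \<in> carrier H"
    using x p by simp
  have "ip H (x \<ominus> p) a = 0" if "a \<in> A" for a
    using that fin x p ip_lincomb_orthonormal[OF A c that]
    by (simp add: ip_minus_left subsetD p_def)
  then have rp: "ip H (x \<ominus> p) p = 0"
    using fin c r unfolding p_def by (subst ip_lincomb_right) (auto simp: p_def)
  have "ip H p x = (\<Sum>a\<in>A. ip H x a * ip H a x)"
    unfolding p_def using fin c x by (intro ip_lincomb_left)
  also have "\<dots> = (\<Sum>a\<in>A. complex_of_real ((cmod (ip H x a))\<^sup>2))"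
    using fin x by (intro sum.cong ip_mult_ip_swap) auto
  finally have px: "Re (ip H p x) = (\<Sum>a\<in>A. (cmod (ip H x a))\<^sup>2)"
    by simp
  \<comment> \<open>Subtraction is split in the second argument, at the price of conjugations that
    the real part removes.\<close>
  have "ip H (x \<ominus> p) (x \<ominus> p) = cnj (ip H (x \<ominus> p) x) - cnj (ip H (x \<ominus> p) p)"
    using r x p by (metis ip_minus_left ip_sym)
  then have "Re (ip H (x \<ominus> p) (x \<ominus> p)) = Re (ip H x x) - Re (ip H p x)"
    using rp x p by (simp add: ip_minus_left)
  then show ?thesis
    using ip_self_nonneg[OF r] px by simp
qed

text \<open>The residual of the expansion is orthogonal to all of \<open>A\<close>, hence zero by
  maximality.\<close>

lemma orthonormal_basis_expansion:
  assumes A: "orthonormal_basis H A" and x: "x \<in> carrier H"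
  shows "lincomb (ip H x) A = x"
proof -
  have o: "orthonormal_set H A" and fin: "finite A" "A \<subseteq> carrier H"
    using A by (auto simp: orthonormal_set_def orthonormal_basis_def)
  have c: "ip H x \<in> A \<rightarrow> K"
    using fin x by (auto intro: ip_closed)
  define p where "p = lincomb (ip H x) A"
  have p: "p \<in> carrier H"
    unfolding p_def using fin c by simp
  have "ip H (x \<ominus> p) a = 0" if "a \<in> A" for a
    using that fin x p ip_lincomb_orthonormal[OF o c that]
    by (simp add: ip_minus_left subsetD p_def)
  then have "x \<ominus> p = \<zero>"
    using A x p unfolding orthonormal_basis_def by simp
  then show ?thesis
    using x p by (simp add: p_def)
qed

lemma parseval_identity:
  assumes A: "orthonormal_basis H A" and x: "x \<in> carrier H" and y: "y \<in> carrier H"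
  shows "ip H x y = (\<Sum>a\<in>A. ip H x a * ip H a y)"
proof -
  have fin: "finite A" "A \<subseteq> carrier H"
    using A by (auto simp: orthonormal_set_def orthonormal_basis_def)
  have c: "ip H x \<in> A \<rightarrow> K"
    using fin x by (auto intro: ip_closed)
  show ?thesis
    using ip_lincomb_left[OF fin c y] orthonormal_basis_expansion[OF A x] by simp
qed

text \<open>
  Double counting of \<open>\<Sum>\<^sub>a \<Sum>\<^sub>b \<bar>\<langle>a, b\<rangle>\<bar>\<^sup>2\<close>: Parseval for each \<open>b\<close>, Bessel for each \<open>a\<close>.
\<close>

lemma card_orthonormal_le_card_basis:
  assumes A: "orthonormal_basis H A" and B: "orthonormal_set H B"
  shows "card B \<le> card A"
proof -
  have o: "orthonormal_set H A" and fin: "finite A" "A \<subseteq> carrier H" "finite B" "B \<subseteq> carrier H"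
    using A B by (auto simp: orthonormal_set_def orthonormal_basis_def)
  have b: "(\<Sum>a\<in>A. (cmod (ip H b a))\<^sup>2) = 1" if "b \<in> B" for b
  proof -
    have "complex_of_real 1 = ip H b b"
      using B that by (simp add: orthonormal_set_def)
    also have "\<dots> = (\<Sum>a\<in>A. ip H b a * ip H a b)"
      using that fin by (intro parseval_identity[OF A]) auto
    also have "\<dots> = (\<Sum>a\<in>A. complex_of_real ((cmod (ip H b a))\<^sup>2))"
      using fin that by (intro sum.cong ip_mult_ip_swap) auto
    also have "\<dots> = complex_of_real (\<Sum>a\<in>A. (cmod (ip H b a))\<^sup>2)"
      by simp
    finally show ?thesis
      by (simp only: of_real_eq_iff)
  qed
  have "real (card B) = (\<Sum>b\<in>B. 1)"
    by simp
  also have "\<dots> = (\<Sum>b\<in>B. \<Sum>a\<in>A. (cmod (ip H b a))\<^sup>2)"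
    using b by simp
  also have "\<dots> = (\<Sum>a\<in>A. \<Sum>b\<in>B. (cmod (ip H a b))\<^sup>2)"
  proof (subst sum.swap, intro sum.cong refl)
    fix a b assume "a \<in> A" "b \<in> B"
    then have "ip H a b = cnj (ip H b a)"
      using fin by (intro ip_sym) auto
    then show "(cmod (ip H b a))\<^sup>2 = (cmod (ip H a b))\<^sup>2"
      by simp
  qed
  also have "\<dots> \<le> (\<Sum>a\<in>A. 1)"
  proof (rule sum_mono)
    fix a assume "a \<in> A"
    then show "(\<Sum>b\<in>B. (cmod (ip H a b))\<^sup>2) \<le> 1"
      using bessel[OF B, of a] o fin by (auto simp: orthonormal_set_def)
  qed
  finally show ?thesis
    by simp
qed

section \<open>Normalization and the Cauchy-Schwarz inequality\<close>

lemma normalized: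
  assumes x: "x \<in> carrier H" "x \<noteq> \<zero>"
  defines "y \<equiv> complex_of_real (1 / hnorm H x) \<odot> x"
  shows "y \<in> carrier H" "ip H y y = 1"
    and "z \<in> carrier H \<Longrightarrow> ip H z y = ip H z x / complex_of_real (hnorm H x)"
proof -
  show "y \<in> carrier H"
    unfolding y_def using x by (intro smult_mem K_closed)
  show zy: "ip H z y = ip H z x / complex_of_real (hnorm H x)" if "z \<in> carrier H" for z
    unfolding y_def using ip_scale_right[OF K_closed(1) x(1) that, of "1 / hnorm H x"] by simp
  have "ip H y y = complex_of_real (1 / hnorm H x) * ip H x y"
    using ip_scale_left[OF K_closed(1) x(1) \<open>y \<in> carrier H\<close>] unfolding y_def .
  also have "\<dots> = ip H x x / (complex_of_real (hnorm H x))\<^sup>2"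
    using zy[OF x(1)] by (simp add: power2_eq_square)
  also have "(complex_of_real (hnorm H x))\<^sup>2 = ip H x x"
    using x ip_self_of_real[of x] by (metis hnorm_power2 of_real_power)
  finally show "ip H y y = 1"
    using ip_pos[OF x] by auto
qed

text \<open>For nonzero \<open>y\<close> this is Bessel's inequality for the one-element orthonormal
  set containing the normalized \<open>y\<close>.\<close>

lemma cauchy_schwarz:
  assumes x: "x \<in> carrier H" and y: "y \<in> carrier H"
  shows "cmod (ip H x y) \<le> hnorm H x * hnorm H y"
proof (cases "y = \<zero>")
  case True
  then show ?thesis
    using x y ip_zero_left[OF x] ip_zero_left[OF y] ip_sym[OF y x] by (simp add: hnorm_def)
next
  case False
  define z where "z = complex_of_real (1 / hnorm H y) \<odot> y"
  note z = normalized[OF y False, folded z_def]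
  have pos: "hnorm H y > 0"
    using ip_pos[OF y False] by (simp add: hnorm_def)
  have "orthonormal_set H {z}"
    using z by (simp add: orthonormal_set_def)
  from bessel[OF this x] have "(cmod (ip H x z))\<^sup>2 \<le> (hnorm H x)\<^sup>2"
    using x by (simp add: hnorm_power2)
  then have "cmod (ip H x z) \<le> hnorm H x"
    using hnorm_nonneg[OF x] by (rule power2_le_imp_le)
  then show ?thesis
    using z(3)[OF x] pos by (simp add: norm_divide field_simps)
qed

section \<open>Existence of orthonormal bases\<close>

lemma orthonormal_set_extend:
  assumes A: "orthonormal_set H A" and "\<not> orthonormal_basis H A"
  obtains b where "b \<notin> A" "orthonormal_set H (insert b A)"
proof -
  obtain x where x: "x \<in> carrier H" "x \<noteq> \<zero>" "\<And>a. a \<in> A \<Longrightarrow> ip H x a = 0"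
    using assms by (auto simp: orthonormal_basis_def)
  define z where "z = complex_of_real (1 / hnorm H x) \<odot> x"
  note z = normalized[OF x(1,2), folded z_def]
  have AH: "A \<subseteq> carrier H"
    using A by (simp add: orthonormal_set_def)
  have za: "ip H a z = 0" "ip H z a = 0" if "a \<in> A" for a
  proof -
    show "ip H a z = 0"
      using z(3)[of a] x that AH ip_sym[of x a] by auto
    then show "ip H z a = 0"
      using ip_sym[of a z] that AH z(1) by auto
  qed
  then have "z \<notin> A"
    using z(2) by auto
  moreover have "orthonormal_set H (insert z A)"
    using A z za \<open>z \<notin> A\<close> by (auto simp: orthonormal_set_def)
  ultimately show ?thesis
    using that by blast
qed

text \<open>Vectors are added until the set is maximal; the bound \<open>N\<close> forces this to
  stop. Two bounds occur: the algebraic dimension for the given spaces, and the size of a known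
  orthonormal basis for the direct sum.\<close>

lemma orthonormal_basis_extending:
  assumes bound: "\<And>B. orthonormal_set H B \<Longrightarrow> card B \<le> N" and A: "orthonormal_set H A"
  obtains B where "A \<subseteq> B" "orthonormal_basis H B"
proof -
  have "\<exists>B. A \<subseteq> B \<and> orthonormal_basis H B"
    using A
  proof (induction "N - card A" arbitrary: A rule: less_induct)
    case less
    show ?case
    proof (cases "orthonormal_basis H A")
      case False
      then obtain b where b: "b \<notin> A" "orthonormal_set H (insert b A)"
        using orthonormal_set_extend[OF less.prems] by blast
      have "card (insert b A) = Suc (card A)"
        using b less.prems by (simp add: orthonormal_set_def)
      then have "N - card (insert b A) < N - card A"
        using bound[OF b(2)] by simp
      from less.hyps[OF this b(2)] show ?thesis
        by auto
    qed auto
  qed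
  then show ?thesis
    using that by blast
qed

text \<open>Pairing a vanishing combination with one of its vectors isolates that vector's
  coefficient.\<close>

lemma orthonormal_set_lin_indpt:
  assumes A: "orthonormal_set H A"
  shows "lin_indpt A"
proof
  assume "lin_dep A"
  then obtain B a v where B: "finite B" "B \<subseteq> A" "a \<in> B \<rightarrow> K" "lincomb a B = \<zero>" "v \<in> B" "a v \<noteq> 0"
    unfolding lin_dep_def by auto
  have "orthonormal_set H B"
    using A B unfolding orthonormal_set_def by blast
  then have "a v = 0"
    using ip_lincomb_orthonormal[of B a v] B A ip_zero_left[of v]
    by (auto simp: orthonormal_set_def subset_iff)
  then show False
    using B by simp
qed

text \<open>The bridge from algebraic dimension to orthonormal vectors: independence bounds their
  number by \<open>dim\<close>, and the expansion shows that a maximal set spans, so it is a basis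
  in the algebraic sense.\<close>

lemma orthonormal_basis_exists:
  assumes fd: "fin_dim"
  obtains A where "orthonormal_basis H A" "card A = dim"
proof -
  have "card B \<le> dim" if "orthonormal_set H B" for B
    using li_le_dim(2)[OF fd _ orthonormal_set_lin_indpt[OF that]] that
    by (simp add: orthonormal_set_def)
  moreover have "orthonormal_set H {}"
    by (simp add: orthonormal_set_def)
  ultimately obtain A where A: "orthonormal_basis H A"
    using orthonormal_basis_extending by metis
  then have o: "orthonormal_set H A" and fin: "finite A" "A \<subseteq> carrier H"
    by (auto simp: orthonormal_basis_def orthonormal_set_def)
  have "x \<in> span A" if x: "x \<in> carrier H" for x
    unfolding span_def
  proof (intro CollectI exI conjI)
    show "x = lincomb (ip H x) A"
      using orthonormal_basis_expansion[OF A x] by simp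
    show "ip H x \<in> A \<rightarrow> carrier (scalar_field K)"
      using fin x by (auto intro: ip_closed)
  qed (use fin in auto)
  then have "basis A"
    unfolding basis_def using orthonormal_set_lin_indpt[OF o] fin span_closed[OF fin(2)] by blast
  then have "card A = dim"
    using dim_basis fin by simp
  then show ?thesis
    using that A by blast
qed

end

lemma hilbert_space_imp_inner_product_space:
  assumes "hilbert_space K H"
  shows "inner_product_space K H"
proof -
  interpret hilbert_space K H by (rule assms)
  show ?thesis
    by unfold_locales
      (fact real_or_complex ip_closed ip_add_left ip_scale_left ip_sym ip_pos)+
qed

section \<open>Direct sums\<close>

text \<open>
  The \<open>module\<close> record inherits the fields \<open>mult\<close> and \<open>one\<close> from rings; they play no role in modules.
\<close>

definition hspace_sum :: "'i set \<Rightarrow> ('i \<Rightarrow> 'b hspace) \<Rightarrow> ('i \<Rightarrow> 'b) hspace" where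
  "hspace_sum J G =
    \<lparr>carrier = (\<Pi>\<^sub>E j\<in>J. carrier (G j)), monoid.mult = undefined, one = undefined,
     zero = (\<lambda>j\<in>J. \<zero>\<^bsub>G j\<^esub>), add = (\<lambda>x y. \<lambda>j\<in>J. x j \<oplus>\<^bsub>G j\<^esub> y j),
     smult = (\<lambda>c x. \<lambda>j\<in>J. c \<odot>\<^bsub>G j\<^esub> x j), ip = (\<lambda>x y. \<Sum>j\<in>J. ip (G j) (x j) (y j))\<rparr>"

lemma hspace_sum_simps [simp]:
  "carrier (hspace_sum J G) = (\<Pi>\<^sub>E j\<in>J. carrier (G j))"
  "\<zero>\<^bsub>hspace_sum J G\<^esub> = (\<lambda>j\<in>J. \<zero>\<^bsub>G j\<^esub>)"
  "x \<oplus>\<^bsub>hspace_sum J G\<^esub> y = (\<lambda>j\<in>J. x j \<oplus>\<^bsub>G j\<^esub> y j)"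
  "c \<odot>\<^bsub>hspace_sum J G\<^esub> x = (\<lambda>j\<in>J. c \<odot>\<^bsub>G j\<^esub> x j)"
  "ip (hspace_sum J G) x y = (\<Sum>j\<in>J. ip (G j) (x j) (y j))"
  by (simp_all add: hspace_sum_def)

text \<open>All axioms hold componentwise. The field is a separate assumption because an empty
  \<open>J\<close> offers no summand to read it off from.\<close>

lemma inner_product_space_hspace_sum:
  assumes K: "field (scalar_field K)" "K = \<real> \<or> K = UNIV" and J: "finite J"
    and G: "\<And>j. j \<in> J \<Longrightarrow> inner_product_space K (G j)"
  shows "inner_product_space K (hspace_sum J G)"
proof -
  let ?D = "hspace_sum J G"
  interpret field "scalar_field K" by (rule K)
  note mod = inner_product_space.axioms(1)[OF G, THEN vectorspace.axioms(1)]
  note ab = mod[THEN module.axioms(2)]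
  note mon = ab[THEN abelian_group.axioms(1)]
  have "abelian_group ?D"
  proof (rule abelian_groupI)
    fix x y z assume "x \<in> carrier ?D" "y \<in> carrier ?D" "z \<in> carrier ?D"
    then show "(x \<oplus>\<^bsub>?D\<^esub> y) \<oplus>\<^bsub>?D\<^esub> z = x \<oplus>\<^bsub>?D\<^esub> (y \<oplus>\<^bsub>?D\<^esub> z)"
      by (auto intro!: restrict_ext abelian_monoid.a_assoc[OF mon])
  next
    fix x y assume "x \<in> carrier ?D" "y \<in> carrier ?D"
    then show "x \<oplus>\<^bsub>?D\<^esub> y = y \<oplus>\<^bsub>?D\<^esub> x" "x \<oplus>\<^bsub>?D\<^esub> y \<in> carrier ?D"
      by (auto intro!: restrict_ext abelian_monoid.a_comm[OF mon] abelian_monoid.a_closed[OF mon])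
  next
    fix x assume x: "x \<in> carrier ?D"
    then show "\<zero>\<^bsub>?D\<^esub> \<oplus>\<^bsub>?D\<^esub> x = x"
      by (auto intro!: PiE_ext[of _ J "\<lambda>j. carrier (G j)"] abelian_monoid.l_zero[OF mon]
          abelian_monoid.a_closed[OF mon] abelian_monoid.zero_closed[OF mon]
          simp: abelian_monoid.l_zero[OF mon])
    show "\<exists>y\<in>carrier ?D. y \<oplus>\<^bsub>?D\<^esub> x = \<zero>\<^bsub>?D\<^esub>"
      using x by (intro bexI[of _ "\<lambda>j\<in>J. \<ominus>\<^bsub>G j\<^esub> x j"])
        (auto intro!: restrict_ext abelian_group.l_neg[OF ab] abelian_group.a_inv_closed[OF ab])
  qed (auto intro!: abelian_monoid.zero_closed[OF mon])
  moreover have "module_axioms (scalar_field K) ?D"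
  proof
    fix a x assume "a \<in> carrier (scalar_field K)" "x \<in> carrier ?D"
    then show "a \<odot>\<^bsub>?D\<^esub> x \<in> carrier ?D"
      by (auto intro!: module.smult_closed[OF mod])
  next
    fix a b x assume "a \<in> carrier (scalar_field K)" "b \<in> carrier (scalar_field K)" "x \<in> carrier ?D"
    then show "(a \<oplus>\<^bsub>scalar_field K\<^esub> b) \<odot>\<^bsub>?D\<^esub> x = a \<odot>\<^bsub>?D\<^esub> x \<oplus>\<^bsub>?D\<^esub> b \<odot>\<^bsub>?D\<^esub> x"
      and "(a \<otimes>\<^bsub>scalar_field K\<^esub> b) \<odot>\<^bsub>?D\<^esub> x = a \<odot>\<^bsub>?D\<^esub> (b \<odot>\<^bsub>?D\<^esub> x)"
      using module.smult_l_distr[OF mod, of _ a b] module.smult_assoc1[OF mod, of _ a b]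
      by (auto intro!: restrict_ext simp: PiE_mem[of x J "\<lambda>j. carrier (G j)"])
  next
    fix a x y assume "a \<in> carrier (scalar_field K)" "x \<in> carrier ?D" "y \<in> carrier ?D"
    then show "a \<odot>\<^bsub>?D\<^esub> (x \<oplus>\<^bsub>?D\<^esub> y) = a \<odot>\<^bsub>?D\<^esub> x \<oplus>\<^bsub>?D\<^esub> a \<odot>\<^bsub>?D\<^esub> y"
      using module.smult_r_distr[OF mod, of _ a]
      by (auto intro!: restrict_ext simp: PiE_mem[of _ J "\<lambda>j. carrier (G j)"])
  next
    fix x assume "x \<in> carrier ?D"
    then show "\<one>\<^bsub>scalar_field K\<^esub> \<odot>\<^bsub>?D\<^esub> x = x"
      using module.smult_one[OF mod]
      by (auto intro!: PiE_ext[of _ J "\<lambda>j. carrier (G j)"]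
          simp: PiE_mem[of x J "\<lambda>j. carrier (G j)"])
  qed
  ultimately have "vectorspace (scalar_field K) ?D"
    by (intro vectorspace.intro module.intro K is_cring)
  moreover have "inner_product_space_axioms K ?D"
  proof
    show "K = \<real> \<or> K = UNIV"
      by (rule K)
  next
    fix x y assume xy: "x \<in> carrier ?D" "y \<in> carrier ?D"
    then have "ip (G j) (x j) (y j) \<in> K" if "j \<in> J" for j
      using inner_product_space.ip_closed[OF G[OF that]] that by auto
    then show "ip ?D x y \<in> K"
      using K(2) by (auto intro!: sum_in_Reals)
    show "ip ?D y x = cnj (ip ?D x y)"
      using xy by (auto intro!: sum.cong inner_product_space.ip_sym[OF G])
    fix z assume "z \<in> carrier ?D"
    then show "ip ?D (x \<oplus>\<^bsub>?D\<^esub> y) z = ip ?D x z + ip ?D y z"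
      using xy by (auto intro!: sum.cong inner_product_space.ip_add_left[OF G]
          simp flip: sum.distrib)
  next
    fix c x y assume "c \<in> K" "x \<in> carrier ?D" "y \<in> carrier ?D"
    then show "ip ?D (c \<odot>\<^bsub>?D\<^esub> x) y = c * ip ?D x y"
      by (auto intro!: sum.cong inner_product_space.ip_scale_left[OF G] simp: sum_distrib_left)
  next
    fix x assume x: "x \<in> carrier ?D" "x \<noteq> \<zero>\<^bsub>?D\<^esub>"
    \<comment> \<open>Members of the carrier are extensional, so a nonzero one is nonzero at an
      index inside \<open>J\<close>.\<close>
    then obtain j where j: "j \<in> J" "x j \<noteq> \<zero>\<^bsub>G j\<^esub>"
      by (metis PiE_restrict hspace_sum_simps(1,2) restrict_ext)
    have "0 < (\<Sum>j\<in>J. Re (ip (G j) (x j) (x j)))"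
    proof (rule sum_pos2[OF J j(1)])
      show "0 < Re (ip (G j) (x j) (x j))"
        using j x by (auto intro!: inner_product_space.ip_pos[OF G])
      show "0 \<le> Re (ip (G i) (x i) (x i))" if "i \<in> J" for i
        using that x by (auto intro!: inner_product_space.ip_self_nonneg[OF G])
    qed
    then show "Re (ip ?D x x) > 0"
      by simp
  qed
  ultimately show ?thesis
    by (rule inner_product_space.intro)
qed

definition hspace_sum_embed :: "'i set \<Rightarrow> ('i \<Rightarrow> 'b hspace) \<Rightarrow> 'i \<Rightarrow> 'b \<Rightarrow> 'i \<Rightarrow> 'b" where
  "hspace_sum_embed J G i b = (\<lambda>j\<in>J. if j = i then b else \<zero>\<^bsub>G j\<^esub>)"

text \<open>The basis is the disjoint union of the given ones, each vector placed in its own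
  summand. Pairing \<open>x\<close> with an embedded vector sees only the component of
  \<open>x\<close> there, which gives both orthonormality and maximality.\<close>

lemma orthonormal_basis_hspace_sum:
  assumes J: "finite J"
    and G: "\<And>j. j \<in> J \<Longrightarrow> inner_product_space K (G j)"
    and B: "\<And>j. j \<in> J \<Longrightarrow> orthonormal_basis (G j) (B j)"
  obtains A where "orthonormal_basis (hspace_sum J G) A" "card A = (\<Sum>j\<in>J. card (B j))"
proof
  let ?D = "hspace_sum J G" and ?e = "\<lambda>(i, b). hspace_sum_embed J G i b"
  let ?A = "?e ` Sigma J B"
  note mon = inner_product_space.axioms(1)[OF G, THEN vectorspace.axioms(1),
      THEN module.axioms(2), THEN abelian_group.axioms(1)]
  have o: "orthonormal_set (G j) (B j)" and fin: "finite (B j)" and BG: "B j \<subseteq> carrier (G j)"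
    if "j \<in> J" for j
    using B[OF that] by (auto simp: orthonormal_basis_def orthonormal_set_def)
  have mem: "hspace_sum_embed J G i b \<in> carrier ?D" if "i \<in> J" "b \<in> B i" for i b
    using that BG[of i] by (auto simp: hspace_sum_embed_def intro: abelian_monoid.zero_closed[OF mon])
  have ipe: "ip ?D x (hspace_sum_embed J G i b) = ip (G i) (x i) b"
    if x: "x \<in> carrier ?D" and ib: "i \<in> J" "b \<in> B i" for x i b
  proof -
    have zero: "ip (G j) (x j) \<zero>\<^bsub>G j\<^esub> = 0" if "j \<in> J" for j
    proof -
      interpret inner_product_space K "G j" by (rule G[OF that])
      have "x j \<in> carrier (G j)"
        using x that by auto
      then show ?thesis
        using ip_sym[of "\<zero>\<^bsub>G j\<^esub>" "x j"] by (simp add: ip_zero_left)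
    qed
    have "ip ?D x (hspace_sum_embed J G i b) = (\<Sum>j\<in>J. if j = i then ip (G i) (x i) b else 0)"
      using zero by (auto simp: hspace_sum_embed_def intro!: sum.cong)
    then show ?thesis
      using J ib by simp
  qed
  have ipee: "ip ?D (hspace_sum_embed J G i b) (hspace_sum_embed J G k c) =
      (if (i, b) = (k, c) then 1 else 0)"
    if "i \<in> J" "b \<in> B i" "k \<in> J" "c \<in> B k" for i b k c
  proof (cases "i = k")
    case True
    then show ?thesis
      using ipe[OF mem] that o[of i] by (auto simp: hspace_sum_embed_def orthonormal_set_def)
  next
    case False
    interpret inner_product_space K "G k" by (rule G[OF that(3)])
    have "c \<in> carrier (G k)"
      using that BG[of k] by auto
    then show ?thesis
      using ipe[OF mem] that False by (auto simp: hspace_sum_embed_def ip_zero_left)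
  qed
  \<comment> \<open>Not automatic: zero vectors of different summands have the same embedding. Basis
    vectors have norm one, and equal embeddings would have inner product 1, which occurs only for
    equal pairs.\<close>
  have inj: "inj_on ?e (Sigma J B)"
  proof (rule inj_onI)
    fix p q assume pq: "p \<in> Sigma J B" "q \<in> Sigma J B" "?e p = ?e q"
    obtain i b k c where s: "p = (i, b)" "q = (k, c)"
      by fastforce
    have "ip ?D (?e p) (?e q) = ip ?D (?e p) (?e p)"
      using pq by simp
    then show "p = q"
      using pq s ipee[of i b k c] ipee[of i b i b] by (auto simp del: hspace_sum_simps split: if_splits)
  qed
  have "ip ?D (?e p) (?e q) = (if ?e p = ?e q then 1 else 0)"
    if "p \<in> Sigma J B" "q \<in> Sigma J B" for p q
    using that ipee inj_on_eq_iff[OF inj that] by (cases p; cases q) (auto simp del: hspace_sum_simps)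
  moreover have "?A \<subseteq> carrier ?D"
    using mem by (auto simp del: hspace_sum_simps)
  moreover have "finite ?A"
    using J fin by auto
  ultimately have "orthonormal_set ?D ?A"
    unfolding orthonormal_set_def by blast
  moreover have "x = \<zero>\<^bsub>?D\<^esub>" if x: "x \<in> carrier ?D" "\<forall>a\<in>?A. ip ?D x a = 0" for x
  proof -
    have "x j = \<zero>\<^bsub>G j\<^esub>" if j: "j \<in> J" for j
    proof -
      have "ip (G j) (x j) b = 0" if "b \<in> B j" for b
        using x ipe[OF x(1) j that] j that by force
      then show ?thesis
        using B[OF j] x(1) j PiE_mem[of x J "\<lambda>j. carrier (G j)" j]
        unfolding orthonormal_basis_def by simp
    qed
    then show ?thesis
      using x by (auto simp: PiE_iff extensional_def)
  qed
  ultimately show "orthonormal_basis ?D ?A"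
    unfolding orthonormal_basis_def by blast
  show "card ?A = (\<Sum>j\<in>J. card (B j))"
    using card_image[OF inj] card_SigmaI[of J B] J fin by simp
qed

section \<open>Adjoints and frame operators\<close>

lemma bounded_opsD:
  assumes "T \<in> bounded_ops K H G"
  shows "x \<in> carrier H \<Longrightarrow> T x \<in> carrier G"
    and "x \<in> carrier H \<Longrightarrow> y \<in> carrier H \<Longrightarrow> T (x \<oplus>\<^bsub>H\<^esub> y) = T x \<oplus>\<^bsub>G\<^esub> T y"
    and "c \<in> K \<Longrightarrow> x \<in> carrier H \<Longrightarrow> T (c \<odot>\<^bsub>H\<^esub> x) = c \<odot>\<^bsub>G\<^esub> T x"
    and "T \<in> extensional (carrier H)"
  using assms by (auto simp: bounded_ops_def LinearCombinations.module_hom_def)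

lemma bounded_opsI:
  assumes "\<And>x. x \<in> carrier H \<Longrightarrow> T x \<in> carrier G"
    and "\<And>x y. x \<in> carrier H \<Longrightarrow> y \<in> carrier H \<Longrightarrow> T (x \<oplus>\<^bsub>H\<^esub> y) = T x \<oplus>\<^bsub>G\<^esub> T y"
    and "\<And>c x. c \<in> K \<Longrightarrow> x \<in> carrier H \<Longrightarrow> T (c \<odot>\<^bsub>H\<^esub> x) = c \<odot>\<^bsub>G\<^esub> T x"
    and "T \<in> extensional (carrier H)"
    and "\<And>x. x \<in> carrier H \<Longrightarrow> hnorm G (T x) \<le> C * hnorm H x"
  shows "T \<in> bounded_ops K H G"
  unfolding bounded_ops_def LinearCombinations.module_hom_def using assms(1-4)
  by (intro CollectI conjI exI[of _ C] ballI assms(5)) auto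

text \<open>Evaluates the definite description: any other adjoint has the same inner products on the
  carrier, and extensionality settles the values outside it.\<close>

lemma hadjoint_eqI:
  assumes "inner_product_space K H" "inner_product_space K G"
    and S: "S \<in> bounded_ops K G H"
    and adj: "\<And>x y. x \<in> carrier H \<Longrightarrow> y \<in> carrier G \<Longrightarrow> ip G (T x) y = ip H x (S y)"
  shows "hadjoint K H G T = S"
  unfolding hadjoint_def
proof (rule the_equality)
  show "S \<in> bounded_ops K G H \<and> (\<forall>x\<in>carrier H. \<forall>y\<in>carrier G. ip G (T x) y = ip H x (S y))"
    using S adj by blast
next
  interpret H: inner_product_space K H by (rule assms)
  fix R assume "R \<in> bounded_ops K G H \<and> (\<forall>x\<in>carrier H. \<forall>y\<in>carrier G. ip G (T x) y = ip H x (R y))"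
  then have R: "R \<in> bounded_ops K G H"
    and adjR: "\<And>x y. x \<in> carrier H \<Longrightarrow> y \<in> carrier G \<Longrightarrow> ip G (T x) y = ip H x (R y)"
    by blast+
  show "R = S"
  proof (rule extensionalityI[of _ "carrier G"])
    show "R \<in> extensional (carrier G)" "S \<in> extensional (carrier G)"
      using bounded_opsD(4)[OF R] bounded_opsD(4)[OF S] .
    fix y assume y: "y \<in> carrier G"
    then have mem: "R y \<in> carrier H" "S y \<in> carrier H"
      using bounded_opsD(1)[OF R] bounded_opsD(1)[OF S] by blast+
    then show "R y = S y"
    proof (rule H.ip_eqI)
      fix z assume z: "z \<in> carrier H"
      then have "ip H z (R y) = ip H z (S y)"
        using adjR adj y by metis
      then show "ip H (R y) z = ip H (S y) z"
        using H.ip_sym[OF z mem(1)] H.ip_sym[OF z mem(2)] by simp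
    qed
  qed
qed

text \<open>A finite orthonormal basis of the domain replaces the Riesz representation theorem: the
  only candidate sends \<open>y\<close> to the combination of the \<open>e\<close> in
  \<open>E\<close> with coefficients \<open>ip G y (T e)\<close>. Its boundedness comes from
  estimating the squared norm of \<open>S y\<close>, which is \<open>ip G (T (S y)) y\<close>, by
  Cauchy-Schwarz and cancelling one factor.\<close>

lemma hadjoint_exists:
  assumes ips: "inner_product_space K H" "inner_product_space K G"
    and E: "orthonormal_basis H E"
    and T: "T \<in> bounded_ops K H G"
  shows "hadjoint K H G T \<in> bounded_ops K G H"
    and "\<And>x y. x \<in> carrier H \<Longrightarrow> y \<in> carrier G \<Longrightarrow> ip G (T x) y = ip H x (hadjoint K H G T y)"
proof -
  interpret H: inner_product_space K H by (rule ips)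
  interpret G: inner_product_space K G by (rule ips)
  have fin: "finite E" "E \<subseteq> carrier H"
    using E by (auto simp: orthonormal_basis_def orthonormal_set_def)
  define S where "S = (\<lambda>y\<in>carrier G. H.lincomb (\<lambda>e. ip G y (T e)) E)"
  have c: "(\<lambda>e. ip G y (T e)) \<in> E \<rightarrow> K" if "y \<in> carrier G" for y
    using that fin by (auto intro!: G.ip_closed bounded_opsD(1)[OF T])
  have Sc: "S y \<in> carrier H" if "y \<in> carrier G" for y
    using that fin c[OF that] by (simp add: S_def)
  have adj: "ip G (T x) y = ip H x (S y)" if x: "x \<in> carrier H" and y: "y \<in> carrier G" for x y
  proof -
    have cx: "ip H x \<in> E \<rightarrow> K"
      using x fin by (auto intro: H.ip_closed)
    have "ip G (T (H.lincomb (ip H x) E)) y = (\<Sum>e\<in>E. ip H x e * ip G (T e) y)"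
      using fin cx y bounded_opsD(1-3)[OF T]
      by (intro H.linear_functional_lincomb) (auto simp: G.ip_add_left G.ip_scale_left)
    then have "ip G (T x) y = (\<Sum>e\<in>E. ip H x e * ip G (T e) y)"
      by (simp add: H.orthonormal_basis_expansion[OF E x])
    also have "\<dots> = (\<Sum>e\<in>E. cnj (ip G y (T e)) * ip H x e)"
    proof (intro sum.cong refl)
      fix e assume "e \<in> E"
      then have "ip G (T e) y = cnj (ip G y (T e))"
        using fin y by (intro G.ip_sym bounded_opsD(1)[OF T]) auto
      then show "ip H x e * ip G (T e) y = cnj (ip G y (T e)) * ip H x e"
        by simp
    qed
    also have "\<dots> = ip H x (S y)"
      using H.ip_lincomb_right[OF fin c[OF y] x] y by (simp add: S_def)
    finally show ?thesis .
  qed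
  \<comment> \<open>The conjugate form puts \<open>S y\<close> on the left, where
    \<open>ip_eqI\<close> can test the linearity of \<open>S\<close>.\<close>
  have adj': "ip H (S y) x = ip G y (T x)" if "x \<in> carrier H" "y \<in> carrier G" for x y
    using adj[OF that] H.ip_sym[OF that(1) Sc[OF that(2)]] G.ip_sym[OF bounded_opsD(1)[OF T that(1)] that(2)]
    by simp
  obtain C where C: "\<And>x. x \<in> carrier H \<Longrightarrow> hnorm G (T x) \<le> C * hnorm H x"
    using T by (auto simp: bounded_ops_def)
  have S: "S \<in> bounded_ops K G H"
  proof (rule bounded_opsI)
    show "S y \<in> carrier H" if "y \<in> carrier G" for y
      by (rule Sc[OF that])
    show "S (x \<oplus>\<^bsub>G\<^esub> y) = S x \<oplus>\<^bsub>H\<^esub> S y" if "x \<in> carrier G" "y \<in> carrier G" for x y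
      using that Sc bounded_opsD(1)[OF T]
      by (intro H.ip_eqI) (auto simp: adj' H.ip_add_left G.ip_add_left)
    show "S (c \<odot>\<^bsub>G\<^esub> y) = c \<odot>\<^bsub>H\<^esub> S y" if "c \<in> K" "y \<in> carrier G" for c y
      using that Sc bounded_opsD(1)[OF T]
      by (intro H.ip_eqI) (auto simp: adj' H.ip_scale_left G.ip_scale_left)
    show "S \<in> extensional (carrier G)"
      by (simp add: S_def)
    fix y assume y: "y \<in> carrier G"
    have n: "0 \<le> hnorm H (S y)" "0 \<le> hnorm G y"
      using y Sc H.hnorm_nonneg G.hnorm_nonneg by auto
    \<comment> \<open>\<open>bounded_ops\<close> puts no sign on \<open>C\<close>; the absolute
      value keeps the bound nonnegative in the case where nothing can be cancelled.\<close>
    show "hnorm H (S y) \<le> \<bar>C\<bar> * hnorm G y"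
    proof (cases "hnorm H (S y) = 0")
      case False
      have "(hnorm H (S y))\<^sup>2 = Re (ip G (T (S y)) y)"
        using y Sc by (simp add: H.hnorm_power2 adj)
      also have "\<dots> \<le> hnorm G (T (S y)) * hnorm G y"
        using y Sc[OF y] bounded_opsD(1)[OF T] G.cauchy_schwarz complex_Re_le_cmod order_trans by metis
      also have "\<dots> \<le> (C * hnorm H (S y)) * hnorm G y"
        using C[OF Sc[OF y]] n by (intro mult_right_mono)
      also have "\<dots> \<le> (\<bar>C\<bar> * hnorm H (S y)) * hnorm G y"
        using n by (intro mult_right_mono) auto
      finally show ?thesis
        using False n by (simp add: power2_eq_square)
    qed (use n in auto)
  qed
  have "hadjoint K H G T = S"
    by (rule hadjoint_eqI[OF ips S adj])
  then show "hadjoint K H G T \<in> bounded_ops K G H"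
    and "\<And>x y. x \<in> carrier H \<Longrightarrow> y \<in> carrier G \<Longrightarrow> ip G (T x) y = ip H x (hadjoint K H G T y)"
    using S adj by simp_all
qed

text \<open>Demanded by \<open>op_le\<close>, which includes self-adjointness of both sides. The
  factor \<open>a\<close> is real and so moves across the inner product without conjugation.\<close>

lemma selfadjoint_scaled_id:
  assumes "inner_product_space K H"
  shows "selfadjoint K H (scaled_id H a)"
proof -
  interpret inner_product_space K H by (rule assms)
  have "scaled_id H a \<in> bounded_ops K H H"
  proof (rule bounded_opsI)
    fix x assume x: "x \<in> carrier H"
    have "(hnorm H (scaled_id H a x))\<^sup>2 = (\<bar>a\<bar> * hnorm H x)\<^sup>2"
      using x by (simp add: scaled_id_def power_mult_distrib hnorm_power2 ip_scale_left ip_scale_right)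
        (simp add: power2_eq_square)
    then show "hnorm H (scaled_id H a x) \<le> \<bar>a\<bar> * hnorm H x"
      using hnorm_nonneg[OF x] by (metis abs_ge_zero mult_nonneg_nonneg order_refl power2_le_imp_le)
  next
    fix c x assume cx: "c \<in> K" "x \<in> carrier H"
    have "c \<odot>\<^bsub>H\<^esub> (complex_of_real a \<odot>\<^bsub>H\<^esub> x) = (c * complex_of_real a) \<odot>\<^bsub>H\<^esub> x"
      using smult_assoc1[of c "complex_of_real a" x] cx by (metis K_closed(1) scalar_field_simps(1,2))
    moreover have "complex_of_real a \<odot>\<^bsub>H\<^esub> (c \<odot>\<^bsub>H\<^esub> x) = (complex_of_real a * c) \<odot>\<^bsub>H\<^esub> x"
      using smult_assoc1[of "complex_of_real a" c x] cx by (metis K_closed(1) scalar_field_simps(1,2))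
    ultimately show "scaled_id H a (c \<odot>\<^bsub>H\<^esub> x) = c \<odot>\<^bsub>H\<^esub> scaled_id H a x"
      using cx by (simp add: scaled_id_def mult.commute)
  next
    fix x y assume "x \<in> carrier H" "y \<in> carrier H"
    then show "scaled_id H a (x \<oplus>\<^bsub>H\<^esub> y) = scaled_id H a x \<oplus>\<^bsub>H\<^esub> scaled_id H a y"
      by (simp add: scaled_id_def smult_r_distr)
  qed (auto simp: scaled_id_def)
  moreover have "ip H (scaled_id H a x) y = ip H x (scaled_id H a y)"
    if "x \<in> carrier H" "y \<in> carrier H" for x y
    using that by (simp add: scaled_id_def ip_scale_left ip_scale_right)
  ultimately show ?thesis
    unfolding selfadjoint_def using hadjoint_eqI[OF assms assms] by blast
qed

text \<open>Eliminates adjoints for good: moving the adjoint of \<open>W j\<close> across leaves the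
  sum of the \<open>ip (G j) (V j x) (W j y)\<close>, the inner product in the direct sum of the two
  tuples. Parseval, tight and dual are the cases used later.\<close>

lemma mixed_frame_op_eq_scaled_id_iff:
  assumes H: "inner_product_space K H" and E: "orthonormal_basis H E"
    and G: "\<And>j. j \<in> {1..m} \<Longrightarrow> inner_product_space K (G j)"
    and W: "\<And>j. j \<in> {1..m} \<Longrightarrow> W j \<in> bounded_ops K H (G j)"
    and V: "\<And>j. j \<in> {1..m} \<Longrightarrow> V j \<in> bounded_ops K H (G j)"
  shows "mixed_frame_op K H m G W V = scaled_id H a \<longleftrightarrow>
    (\<forall>x\<in>carrier H. \<forall>y\<in>carrier H.
      (\<Sum>j=1..m. ip (G j) (V j x) (W j y)) = complex_of_real a * ip H x y)"
proof -
  interpret H: inner_product_space K H by (rule H)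
  let ?M = "mixed_frame_op K H m G W V"
  note adj = hadjoint_exists[OF H G E W]
  have mem: "hadjoint K H (G j) (W j) (V j x) \<in> carrier H" if "x \<in> carrier H" "j \<in> {1..m}" for x j
    using bounded_opsD(1)[OF adj(1)] bounded_opsD(1)[OF V] that by blast
  have M: "?M x \<in> carrier H" if "x \<in> carrier H" for x
    using mem that by (auto simp: mixed_frame_op_def intro!: H.M.finsum_closed)
  have ipM: "ip H (?M x) y = (\<Sum>j=1..m. ip (G j) (V j x) (W j y))"
    if x: "x \<in> carrier H" and y: "y \<in> carrier H" for x y
  proof -
    have "ip H (?M x) y = (\<Sum>j=1..m. ip H (hadjoint K H (G j) (W j) (V j x)) y)"
      using x y mem by (simp add: mixed_frame_op_def H.ip_finsum_left)
    also have "\<dots> = (\<Sum>j=1..m. ip (G j) (V j x) (W j y))"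
    proof (intro sum.cong refl)
      fix j assume j: "j \<in> {1..m}"
      interpret G: inner_product_space K "G j" by (rule G[OF j])
      have c: "V j x \<in> carrier (G j)" "W j y \<in> carrier (G j)"
        using bounded_opsD(1)[OF V[OF j] x] bounded_opsD(1)[OF W[OF j] y] .
      have "ip H (hadjoint K H (G j) (W j) (V j x)) y = cnj (ip (G j) (W j y) (V j x))"
        using adj(2)[OF j j y c(1)] H.ip_sym[OF y mem[OF x j]] by simp
      then show "ip H (hadjoint K H (G j) (W j) (V j x)) y = ip (G j) (V j x) (W j y)"
        using G.ip_sym[OF c(2,1)] by simp
    qed
    finally show ?thesis .
  qed
  have ips: "ip H (scaled_id H a x) y = complex_of_real a * ip H x y"
    if "x \<in> carrier H" "y \<in> carrier H" for x y
    using that by (simp add: scaled_id_def H.ip_scale_left)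
  show ?thesis
  proof
    assume "?M = scaled_id H a"
    then show "\<forall>x\<in>carrier H. \<forall>y\<in>carrier H.
        (\<Sum>j=1..m. ip (G j) (V j x) (W j y)) = complex_of_real a * ip H x y"
      using ipM ips by simp
  next
    assume *: "\<forall>x\<in>carrier H. \<forall>y\<in>carrier H.
        (\<Sum>j=1..m. ip (G j) (V j x) (W j y)) = complex_of_real a * ip H x y"
    show "?M = scaled_id H a"
    proof (rule extensionalityI[of _ "carrier H"])
      fix x assume x: "x \<in> carrier H"
      show "?M x = scaled_id H a x"
      proof (rule H.ip_eqI)
        show "scaled_id H a x \<in> carrier H"
          using x by (simp add: scaled_id_def)
      qed (use M x * ipM ips in auto)
    qed (auto simp: mixed_frame_op_def scaled_id_def)
  qed
qed

text \<open>Both frame bounds are taken to be \<open>a\<close>, so the two operator inequalities are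
  reflexive.\<close>

lemma tight_opv_frame_with_boundI:
  assumes "inner_product_space K H" and "a > 0"
    and "W \<in> (\<Pi>\<^sub>E j\<in>{1..m}. bounded_ops K H (G j))"
    and "mixed_frame_op K H m G W W = scaled_id H a"
  shows "tight_opv_frame_with_bound K H m G a W"
proof -
  have "op_le K H (scaled_id H a) (scaled_id H a)"
    using selfadjoint_scaled_id[OF assms(1)] by (simp add: op_le_def)
  then show ?thesis
    unfolding tight_opv_frame_with_bound_def opv_frame_def assms(4) using assms(2,3) by blast
qed

section \<open>Tight duals\<close>

lemma orthogonal_isometry_exists:
  assumes ips: "inner_product_space K H" "inner_product_space K D"
    and E: "orthonormal_basis H E" and F: "orthonormal_basis D F"
    and card: "2 * card E \<le> card F"
    and T_closed: "\<And>x. x \<in> carrier H \<Longrightarrow> T x \<in> carrier D"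
    and T_add: "\<And>x y. x \<in> carrier H \<Longrightarrow> y \<in> carrier H \<Longrightarrow> T (x \<oplus>\<^bsub>H\<^esub> y) = T x \<oplus>\<^bsub>D\<^esub> T y"
    and T_scale: "\<And>c x. c \<in> K \<Longrightarrow> x \<in> carrier H \<Longrightarrow> T (c \<odot>\<^bsub>H\<^esub> x) = c \<odot>\<^bsub>D\<^esub> T x"
    and T_ip: "\<And>x y. x \<in> carrier H \<Longrightarrow> y \<in> carrier H \<Longrightarrow> ip D (T x) (T y) = ip H x y"
  obtains U where
    "\<And>x. x \<in> carrier H \<Longrightarrow> U x \<in> carrier D"
    "\<And>x y. x \<in> carrier H \<Longrightarrow> y \<in> carrier H \<Longrightarrow> U (x \<oplus>\<^bsub>H\<^esub> y) = U x \<oplus>\<^bsub>D\<^esub> U y"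
    "\<And>c x. c \<in> K \<Longrightarrow> x \<in> carrier H \<Longrightarrow> U (c \<odot>\<^bsub>H\<^esub> x) = c \<odot>\<^bsub>D\<^esub> U x"
    "\<And>x y. x \<in> carrier H \<Longrightarrow> y \<in> carrier H \<Longrightarrow> ip D (U x) (U y) = ip H x y"
    "\<And>x y. x \<in> carrier H \<Longrightarrow> y \<in> carrier H \<Longrightarrow> ip D (T x) (U y) = 0"
proof -
  interpret H: inner_product_space K H by (rule ips)
  interpret D: inner_product_space K D by (rule ips)
  have Eo: "\<And>e e'. e \<in> E \<Longrightarrow> e' \<in> E \<Longrightarrow> ip H e e' = (if e = e' then 1 else 0)"
    and fin: "finite E" "E \<subseteq> carrier H" and Fo: "orthonormal_set D F"
    using E F by (auto simp: orthonormal_basis_def orthonormal_set_def)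
  have TE: "ip D (T e) (T e') = (if e = e' then 1 else 0)" if "e \<in> E" "e' \<in> E" for e e'
    using that Eo T_ip fin by (metis subsetD)
  have inj: "inj_on T E"
    by (rule inj_onI) (metis TE zero_neq_one)
  have "orthonormal_set D (T ` E)"
    using TE inj_on_eq_iff[OF inj] fin T_closed unfolding orthonormal_set_def by auto
  \<comment> \<open>\<open>F\<close> serves twice: as a basis it bounds every orthonormal set, so
    the extension exists; below, as an orthonormal set, it bounds \<open>card B\<close> from
    below.\<close>
  then obtain B where TB: "T ` E \<subseteq> B" and B: "orthonormal_basis D B"
    using D.orthonormal_basis_extending[OF D.card_orthonormal_le_card_basis[OF F]] by metis
  have Bo: "\<And>b b'. b \<in> B \<Longrightarrow> b' \<in> B \<Longrightarrow> ip D b b' = (if b = b' then 1 else 0)"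
    and Bfin: "finite B" "B \<subseteq> carrier D"
    using B by (auto simp: orthonormal_basis_def orthonormal_set_def)
  have "card (B - T ` E) = card B - card E"
    using TB fin card_image[OF inj] by (simp add: card_Diff_subset)
  moreover have "card F \<le> card B"
    by (rule D.card_orthonormal_le_card_basis[OF B Fo])
  ultimately have "card E \<le> card (B - T ` E)"
    using card by linarith
  then obtain C where C: "C \<subseteq> B - T ` E" "card C = card E" "finite C"
    using obtain_subset_with_card_n by metis
  then obtain v where v: "bij_betw v C E"
    using finite_same_card_bij fin by metis
  have vE: "v b \<in> carrier H" if "b \<in> C" for b
    using that v fin by (auto dest: bij_betwE)
  have CD: "C \<subseteq> carrier D" and Co: "orthonormal_set D C"
    using C Bo Bfin by (auto simp: orthonormal_set_def subset_iff)
  \<comment> \<open>The linear map sending \<open>v b\<close> to \<open>b\<close>. As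
    \<open>v\<close> runs from \<open>C\<close> to \<open>E\<close>, no inverse bijection is needed,
    and reindexing along \<open>v\<close> turns \<open>ip D (U x) (U y)\<close> into Parseval's
    identity in \<open>H\<close>.\<close>
  define U where "U x = D.lincomb (\<lambda>b. ip H x (v b)) C" for x
  have c: "(\<lambda>b. ip H x (v b)) \<in> C \<rightarrow> K" if "x \<in> carrier H" for x
    using that vE by (auto intro: H.ip_closed)
  have Uc: "U x \<in> carrier D" if "x \<in> carrier H" for x
    unfolding U_def using CD c[OF that] by simp
  have ipU: "ip D (U x) z = (\<Sum>b\<in>C. ip H x (v b) * ip D b z)"
    if "x \<in> carrier H" "z \<in> carrier D" for x z
    unfolding U_def using CD C c that by (intro D.ip_lincomb_left)
  have bU: "ip D b (U y) = ip H (v b) y" if "y \<in> carrier H" "b \<in> C" for y b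
  proof -
    have "ip D b (U y) = cnj (ip D (U y) b)"
      using that CD Uc by (intro D.ip_sym) auto
    also have "ip D (U y) b = ip H y (v b)"
      unfolding U_def by (rule D.ip_lincomb_orthonormal[OF Co c[OF that(1)] that(2)])
    finally show ?thesis
      using H.ip_sym[OF that(1) vE[OF that(2)]] by simp
  qed
  have TC: "ip D (T x) b = 0" if x: "x \<in> carrier H" and b: "b \<in> C" for x b
  proof -
    have bD: "b \<in> carrier D"
      using b CD by auto
    have "ip D (T (H.lincomb (ip H x) E)) b = (\<Sum>e\<in>E. ip H x e * ip D (T e) b)"
      using fin x bD
      by (intro H.linear_functional_lincomb)
        (auto simp: T_add T_scale T_closed D.ip_add_left D.ip_scale_left intro: H.ip_closed)
    also have "\<dots> = 0"
      using Bo TB C b by (intro sum.neutral ballI) (auto simp: subset_iff)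
    finally show ?thesis
      by (simp add: H.orthonormal_basis_expansion[OF E x])
  qed
  show ?thesis
  proof (rule that[of U])
    fix x y assume x: "x \<in> carrier H" and y: "y \<in> carrier H"
    show "U (x \<oplus>\<^bsub>H\<^esub> y) = U x \<oplus>\<^bsub>D\<^esub> U y"
      using x y Uc vE
      by (intro D.ip_eqI)
        (auto simp: ipU D.ip_add_left H.ip_add_left ring_distribs simp flip: sum.distrib)
    have "ip D (U x) (U y) = (\<Sum>b\<in>C. ip H x (v b) * ip H (v b) y)"
      using x y Uc bU by (simp add: ipU)
    also have "\<dots> = (\<Sum>e\<in>E. ip H x e * ip H e y)"
      using sum.reindex_bij_betw[OF v, of "\<lambda>e. ip H x e * ip H e y"] .
    also have "\<dots> = ip H x y"
      by (rule H.parseval_identity[OF E x y, symmetric])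
    finally show "ip D (U x) (U y) = ip H x y" .
    have "ip D (T x) (U y) = (\<Sum>b\<in>C. cnj (ip H y (v b)) * ip D (T x) b)"
      unfolding U_def using C CD c[OF y] T_closed[OF x] by (intro D.ip_lincomb_right) auto
    then show "ip D (T x) (U y) = 0"
      using TC[OF x] by simp
  next
    fix a x assume a: "a \<in> K" and x: "x \<in> carrier H"
    show "U (a \<odot>\<^bsub>H\<^esub> x) = a \<odot>\<^bsub>D\<^esub> U x"
      using a x Uc vE
      by (intro D.ip_eqI)
        (auto simp: ipU D.ip_scale_left H.ip_scale_left sum_distrib_left mult.assoc)
  qed (rule Uc)
qed

theorem proposition13:
  fixes K :: "complex set"
    and H :: "'a hspace"
    and G :: "nat \<Rightarrow> 'b hspace"
    and V :: "nat \<Rightarrow> 'a \<Rightarrow> 'b"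
    and n m l :: nat
    and ls :: "nat \<Rightarrow> nat"
  assumes "hilbert_space_of_dim K H n"
    and "\<And>j. j \<in> {1..m} \<Longrightarrow> hilbert_space_of_dim K (G j) (ls j)"
    and "l = (\<Sum>j=1..m. ls j)"
    and "parseval_opv_frame K H m G V"
    and "l \<ge> 2 * n"
  shows "infinite {W. tight_opv_frame K H m G W \<and> dual_opv_frame K H m G V W}"
proof -
  have hs: "hilbert_space K H"
    using assms(1) by (simp add: hilbert_space_of_dim_def)
  note ipsH = hilbert_space_imp_inner_product_space[OF hs]
  interpret H: inner_product_space K H by (rule ipsH)
  obtain E where E: "orthonormal_basis H E" "card E = n"
    using H.orthonormal_basis_exists assms(1) by (auto simp: hilbert_space_of_dim_def)
  have ipsG: "inner_product_space K (G j)" if "j \<in> {1..m}" for j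
    using assms(2)[OF that] hilbert_space_imp_inner_product_space
    by (auto simp: hilbert_space_of_dim_def)
  have "\<exists>B. orthonormal_basis (G j) B \<and> card B = ls j" if "j \<in> {1..m}" for j
    using inner_product_space.orthonormal_basis_exists[OF ipsG[OF that]] assms(2)[OF that]
    unfolding hilbert_space_of_dim_def by metis
  then obtain B where B: "\<And>j. j \<in> {1..m} \<Longrightarrow> orthonormal_basis (G j) (B j)"
    and cardB: "\<And>j. j \<in> {1..m} \<Longrightarrow> card (B j) = ls j"
    by metis
  define D where "D = hspace_sum {1..m} G"
  have ipsD: "inner_product_space K D"
    unfolding D_def using H.field_axioms H.real_or_complex ipsG
    by (intro inner_product_space_hspace_sum) auto
  interpret D: inner_product_space K D by (rule ipsD)
  obtain F where F: "orthonormal_basis D F" "card F = (\<Sum>j=1..m. card (B j))"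
    unfolding D_def by (rule orthonormal_basis_hspace_sum[OF finite_atLeastAtMost ipsG B])
  then have cardF: "2 * card E \<le> card F"
    using cardB assms(3,5) E(2) by simp
  have ipD: "ip D x y = (\<Sum>j=1..m. ip (G j) (x j) (y j))" for x y
    by (simp add: D_def)
  have D_proj: "x j \<in> carrier (G j)" if "x \<in> carrier D" "j \<in> {1..m}" for x j
    using that by (auto simp: D_def)

  have V: "V \<in> (\<Pi>\<^sub>E j\<in>{1..m}. bounded_ops K H (G j))"
    and parseval: "mixed_frame_op K H m G V V = scaled_id H 1"
    using assms(4)
    by (auto simp: parseval_opv_frame_def tight_opv_frame_with_bound_def opv_frame_def)
  have Vb: "V j \<in> bounded_ops K H (G j)" if "j \<in> {1..m}" for j
    using V that by auto
  note Vj = bounded_opsD(1-3)[OF Vb]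
  \<comment> \<open>The restriction matters: \<open>V\<close> is \<open>undefined\<close> outside
    the index range, but \<open>undefined x\<close> need not be the \<open>undefined\<close> that
    the carrier of \<open>D\<close> demands there.\<close>
  define T where "T x = (\<lambda>j\<in>{1..m}. V j x)" for x
  have T_closed: "T x \<in> carrier D" if "x \<in> carrier H" for x
    using that Vj(1) by (auto simp: T_def D_def)
  have T_add: "T (x \<oplus>\<^bsub>H\<^esub> y) = T x \<oplus>\<^bsub>D\<^esub> T y" if "x \<in> carrier H" "y \<in> carrier H" for x y
    using that Vj(2) by (auto simp: T_def D_def intro!: restrict_ext)
  have T_scale: "T (c \<odot>\<^bsub>H\<^esub> x) = c \<odot>\<^bsub>D\<^esub> T x" if "c \<in> K" "x \<in> carrier H" for c x
    using that Vj(3) by (auto simp: T_def D_def intro!: restrict_ext)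
  \<comment> \<open>The Parseval property is exactly the isometry of \<open>T\<close>: bound 1 in
    the characterization of frame operators.\<close>
  have T_ip: "ip D (T x) (T y) = ip H x y" if "x \<in> carrier H" "y \<in> carrier H" for x y
    using parseval that mixed_frame_op_eq_scaled_id_iff[OF ipsH E(1) ipsG Vb Vb, where a = 1]
    by (simp add: ipD T_def)
  obtain U where U_closed: "\<And>x. x \<in> carrier H \<Longrightarrow> U x \<in> carrier D"
    and U_add: "\<And>x y. x \<in> carrier H \<Longrightarrow> y \<in> carrier H \<Longrightarrow> U (x \<oplus>\<^bsub>H\<^esub> y) = U x \<oplus>\<^bsub>D\<^esub> U y"
    and U_scale: "\<And>c x. c \<in> K \<Longrightarrow> x \<in> carrier H \<Longrightarrow> U (c \<odot>\<^bsub>H\<^esub> x) = c \<odot>\<^bsub>D\<^esub> U x"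
    and U_ip: "\<And>x y. x \<in> carrier H \<Longrightarrow> y \<in> carrier H \<Longrightarrow> ip D (U x) (U y) = ip H x y"
    and TU: "\<And>x y. x \<in> carrier H \<Longrightarrow> y \<in> carrier H \<Longrightarrow> ip D (T x) (U y) = 0"
    using orthogonal_isometry_exists[OF ipsH ipsD E(1) F(1) cardF T_closed T_add T_scale T_ip]
    by blast
  have UT: "ip D (U x) (T y) = 0" if "x \<in> carrier H" "y \<in> carrier H" for x y
    using D.ip_sym[OF T_closed U_closed] TU that by simp

  \<comment> \<open>A real \<open>c\<close> belongs to \<open>K\<close> for both fields and is its
    own conjugate.\<close>
  define S where "S c x = T x \<oplus>\<^bsub>D\<^esub> complex_of_real c \<odot>\<^bsub>D\<^esub> U x" for c x
  have S_closed: "S c x \<in> carrier D" if "x \<in> carrier H" for c x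
    using that T_closed U_closed by (simp add: S_def)
  \<comment> \<open>Linearity is tested against vectors of \<open>D\<close>, which replaces
    rearranging sums in \<open>D\<close> by arithmetic of complex numbers.\<close>
  have S_add: "S c (x \<oplus>\<^bsub>H\<^esub> y) = S c x \<oplus>\<^bsub>D\<^esub> S c y" if "x \<in> carrier H" "y \<in> carrier H" for c x y
    using that T_closed U_closed T_add U_add S_closed
    by (intro D.ip_eqI) (auto simp: S_def D.ip_add_left D.ip_scale_left algebra_simps)
  have S_scale: "S c (a \<odot>\<^bsub>H\<^esub> x) = a \<odot>\<^bsub>D\<^esub> S c x" if "a \<in> K" "x \<in> carrier H" for a c x
    using that T_closed U_closed T_scale U_scale S_closed
    by (intro D.ip_eqI) (auto simp: S_def D.ip_add_left D.ip_scale_left algebra_simps)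
  \<comment> \<open>This will be duality: the part of \<open>S c y\<close> in the range of
    \<open>U\<close> is invisible to \<open>T x\<close>, whatever \<open>c\<close> is.\<close>
  have TS: "ip D (T x) (S c y) = ip H x y" if "x \<in> carrier H" "y \<in> carrier H" for c x y
    using that T_closed U_closed
    by (simp add: S_def D.ip_add_right D.ip_scale_right T_ip TU)
  \<comment> \<open>Pythagoras: \<open>T\<close> contributes 1, \<open>U\<close> contributes
    \<open>c\<^sup>2\<close>, and both cross terms vanish.\<close>
  have SS: "ip D (S c x) (S c y) = complex_of_real (1 + c\<^sup>2) * ip H x y"
    if "x \<in> carrier H" "y \<in> carrier H" for c x y
  proof -
    have "ip D (U x) (S c y) = complex_of_real c * ip H x y"
      using that T_closed U_closed
      by (simp add: S_def D.ip_add_right D.ip_scale_right U_ip UT)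
    moreover have "ip D (S c x) (S c y) = ip D (T x) (S c y) + complex_of_real c * ip D (U x) (S c y)"
      using that T_closed U_closed S_closed[OF that(2)]
      unfolding S_def[of c x] by (simp add: D.ip_add_left D.ip_scale_left)
    ultimately show ?thesis
      using TS[OF that] by (simp add: algebra_simps power2_eq_square)
  qed

  \<comment> \<open>Restricted in the index and in the vector, as the extensional families to be
    counted require.\<close>
  define W where "W c = (\<lambda>j\<in>{1..m}. \<lambda>x\<in>carrier H. S c x j)" for c
  have Wb: "W c j \<in> bounded_ops K H (G j)" if j: "j \<in> {1..m}" for c j
  proof (rule bounded_opsI)
    fix x assume x: "x \<in> carrier H"
    show Wx: "W c j x \<in> carrier (G j)"
      using D_proj[OF S_closed[OF x] j] x j by (simp add: W_def)
    \<comment> \<open>One component is no longer than the whole tuple, whose squared norm is known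
      from \<open>SS\<close>; this is the source of the operator bound
      \<open>sqrt (1 + c\<^sup>2)\<close>.\<close>
    have "Re (ip (G j) (S c x j) (S c x j)) \<le> (\<Sum>i=1..m. Re (ip (G i) (S c x i) (S c x i)))"
    proof (rule member_le_sum[OF j])
      show "0 \<le> Re (ip (G i) (S c x i) (S c x i))" if "i \<in> {1..m} - {j}" for i
        using that inner_product_space.ip_self_nonneg[OF ipsG] D_proj[OF S_closed[OF x]] by auto
    qed auto
    also have "\<dots> = (1 + c\<^sup>2) * Re (ip H x x)"
      using arg_cong[OF SS[OF x x, of c], of Re] unfolding ipD by (simp del: of_real_add)
    finally have "hnorm (G j) (S c x j) \<le> sqrt ((1 + c\<^sup>2) * Re (ip H x x))"
      by (simp add: hnorm_def)
    then show "hnorm (G j) (W c j x) \<le> sqrt (1 + c\<^sup>2) * hnorm H x"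
      using x j by (simp add: W_def hnorm_def real_sqrt_mult)
  next
    fix x y assume "x \<in> carrier H" "y \<in> carrier H"
    then show "W c j (x \<oplus>\<^bsub>H\<^esub> y) = W c j x \<oplus>\<^bsub>G j\<^esub> W c j y"
      using j S_add by (simp add: W_def D_def)
  next
    fix a x assume "a \<in> K" "x \<in> carrier H"
    then show "W c j (a \<odot>\<^bsub>H\<^esub> x) = a \<odot>\<^bsub>G j\<^esub> W c j x"
      using j S_scale by (simp add: W_def D_def)
  qed (use j in \<open>simp add: W_def\<close>)
  have WPi: "W c \<in> (\<Pi>\<^sub>E j\<in>{1..m}. bounded_ops K H (G j))" for c
    using Wb by (auto simp: W_def PiE_iff)
  have WW: "mixed_frame_op K H m G (W c) (W c) = scaled_id H (1 + c\<^sup>2)" for c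
    by (rule mixed_frame_op_eq_scaled_id_iff[THEN iffD2, OF ipsH E(1) ipsG Wb Wb])
      (use SS in \<open>simp_all add: W_def ipD\<close>)
  have WV: "mixed_frame_op K H m G (W c) V = scaled_id H 1" for c
    by (rule mixed_frame_op_eq_scaled_id_iff[THEN iffD2, OF ipsH E(1) ipsG Wb Vb])
      (use TS in \<open>simp_all add: W_def T_def ipD\<close>)
  have tight: "tight_opv_frame_with_bound K H m G (1 + c\<^sup>2) (W c)" for c
    by (intro tight_opv_frame_with_boundI ipsH WPi WW) (simp add: add_pos_nonneg)
  \<comment> \<open>Natural numbers suffice as parameters, since their squares are already
    distinct.\<close>
  then have "range (\<lambda>k. W (real k)) \<subseteq> {W. tight_opv_frame K H m G W \<and> dual_opv_frame K H m G V W}"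
    using WV by (auto simp: tight_opv_frame_def dual_opv_frame_def tight_opv_frame_with_bound_def)
  moreover have "inj (\<lambda>k. W (real k))"
  proof (rule injI)
    fix k k' assume "W (real k) = W (real k')"
    then have eq: "scaled_id H (1 + (real k)\<^sup>2) = scaled_id H (1 + (real k')\<^sup>2)"
      by (metis WW)
    \<comment> \<open>Multiples of the identity can be told apart only on a nonzero vector; here
      \<open>H\<close> being nonzero is essential.\<close>
    obtain x where x: "x \<in> carrier H" "x \<noteq> \<zero>\<^bsub>H\<^esub>"
      using hilbert_space.nonzero[OF hs] H.M.zero_closed by blast
    have ips: "Re (ip H (scaled_id H a x) x) = a * Re (ip H x x)" for a
      using x by (simp add: scaled_id_def H.ip_scale_left)
    have "(1 + (real k)\<^sup>2) * Re (ip H x x) = (1 + (real k')\<^sup>2) * Re (ip H x x)"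
      using ips eq by metis
    then show "k = k'"
      using H.ip_pos[OF x] by simp
  qed
  ultimately show ?thesis
    using infinite_super range_inj_infinite by blast
qed

end
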